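(* Let $T\in\mathcal D$ be a target concept. Suppose there exist $d\in\mathbb N$ and a map $G_d:[\Delta\times\{0,1\}]^d\to\mathcal D$ such that, for every $m\ge d$: (1) for all $I_d\in\mathcal I_d$, the hypothesis $H_{I_d}=G_d\big(\{(\delta_i,\mathbf 1_T(\delta_i))\}_{i\in I_d}\big)$ is consistent with $\{(\delta_i,\mathbf 1_T(\delta_i))\}_{i\in I_d}$; (2) with $\mathbb P^m$-probability one, for the labeled $m$-multisample $\{(\delta_i,\mathbf 1_T(\delta_i))\}_{i=1}^m$ there exists a unique $I_d\in\mathcal I_d$ such that $H_{I_d}$ is consistent with the whole labeled $m$-multisample. For $m\ge d$ let $m_d=m_d\big(\{(\delta_i,\mathbf 1_T(\delta_i))\}_{i=1}^m\big)\in\mathcal I_d$ denote this ($\mathbb P^m$-almost surely) unique set of indices, and let $A_m\big(\{(\delta_i,\mathbf 1_T(\delta_i))\}_{i=1}^m\big)=H_m:=G_d\big(\{(\delta_i,\mathbf 1_T(\delta_i))\}_{i\in m_d}\big)$. Then the algorithm $\{A_m\}_{m\ge d}$ is PAC-T with $q(m,\epsilon)=\sum_{i=0}^{d-1}\binom{m}{i}\epsilon^i(1-\epsilon)^{m-i}$, and in particular, for any $\epsilon\in(0,1)$ and any $m\ge d$, $$\mathbb P^m\Big\{(\delta_1,\ldots,\delta_m)\in\Delta^m:\ d_{\mathbb P}(T,H_m)>\epsilon\Big\}=\sum_{i=0}^{d-1}\binom{m}{i}\epsilon^i(1-\epsilon)^{m-i}.$$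
   Context: $\Delta\subseteq\mathbb R^{n_\delta}$ is a set endowed with a $\sigma$-algebra $\mathcal D$, $\mathbb P$ is a probability measure on $\mathcal D$, and $\mathbb P^m$ is the product measure on $\Delta^m$ (so $\delta_1,\dots,\delta_m$ are i.i.d. with law $\mathbb P$). $\mathbb N$ denotes the positive integers. All involved sets are assumed measurable. Elements of $\mathcal D$ are called concepts or hypotheses; $T\in\mathcal D$ is a fixed target concept; $\mathbf 1_C$ is the indicator function of $C$. A labeled $m$-multisample is $\{(\delta_i,\mathbf 1_T(\delta_i))\}_{i=1}^m\in[\Delta\times\{0,1\}]^m$. For an index set $J$, a hypothesis $H\in\mathcal D$ is consistent with $\{(\delta_i,\mathbf 1_T(\delta_i))\}_{i\in J}$ iff $\mathbf 1_H(\delta_i)=\mathbf 1_T(\delta_i)$ for all $i\in J$. The error is $d_{\mathbb P}(T,H)=\mathbb P(\{\delta\in\Delta:\mathbf 1_H(\delta)\ne\mathbf 1_T(\delta)\})$. For $m\ge d$, $\mathcal I_d$ is the set of all $\binom md$ subsets $I_d\subseteq\{1,\dots,m\}$ with $d$ elements; when $G_d$ is applied to samples indexed by $I_d$, they are listed in increasing order of index. PAC-T: an algorithm is a family of maps $A_m:[\Delta\times\{0,1\}]^m\to\mathcal D$, $m\ge m_0$, and $H_m$ is the hypothesis returned by $A_m$ on the labeled $m$-multisample. It is PAC-T with $q(m,\epsilon)$ if for all $\epsilon\in(0,1)$ and $m\ge m_0$, $\mathbb P^m\{d_{\mathbb P}(T,H_m)>\epsilon\}\le q(m,\epsilon)$,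 where $q:\mathbb N\times(0,1)\to[0,1]$ satisfies $\lim_{m\to\infty}q(m,\epsilon)=0$ for each $\epsilon$. *)

theory Defs
  imports "HOL-Probability.Probability"
begin

text \<open>
  A measure space \<open>M\<close> carries the domain as \<open>space M\<close>, the concepts as \<open>sets M\<close> and the law as its
  measure.  An unlabeled \<open>m\<close>-multisample is a point of the product space over the index set
  \<open>{1..m}\<close>; a tuple of labeled points is a list with labels in \<open>{0, 1 :: nat}\<close>.
\<close>

abbreviation sample_space :: "'a measure \<Rightarrow> nat \<Rightarrow> (nat \<Rightarrow> 'a) measure" where
  "sample_space M m \<equiv> Pi\<^sub>M {1..m} (\<lambda>_. M)"

definition labeled_tuples :: "'a measure \<Rightarrow> nat \<Rightarrow> ('a \<times> nat) list set" where
  "labeled_tuples M k = {s. length s = k \<and> set s \<subseteq> space M \<times> {0, 1}}"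

text \<open>The labeled samples with index in the finite set \<open>J\<close>, in increasing order of index.\<close>

definition labeled :: "'a set \<Rightarrow> nat set \<Rightarrow> (nat \<Rightarrow> 'a) \<Rightarrow> ('a \<times> nat) list" where
  "labeled T J \<delta> = map (\<lambda>i. (\<delta> i, indicator T (\<delta> i))) (sorted_list_of_set J)"

definition consistent :: "'a set \<Rightarrow> 'a set \<Rightarrow> nat set \<Rightarrow> (nat \<Rightarrow> 'a) \<Rightarrow> bool" where
  "consistent T H J \<delta> \<longleftrightarrow> (\<forall>i\<in>J. (indicator H (\<delta> i) :: nat) = indicator T (\<delta> i))"

definition error :: "'a measure \<Rightarrow> 'a set \<Rightarrow> 'a set \<Rightarrow> real" where
  "error M T H = measure M {x \<in> space M. (indicator H x :: nat) \<noteq> indicator T x}"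

definition index_sets :: "nat \<Rightarrow> nat \<Rightarrow> nat set set" where
  "index_sets d m = {I. I \<subseteq> {1..m} \<and> card I = d}"

definition is_compression_set ::
    "'a set \<Rightarrow> (('a \<times> nat) list \<Rightarrow> 'a set) \<Rightarrow> nat \<Rightarrow> nat \<Rightarrow> (nat \<Rightarrow> 'a) \<Rightarrow> nat set \<Rightarrow> bool" where
  "is_compression_set T G d m \<delta> I \<longleftrightarrow>
     I \<in> index_sets d m \<and> consistent T (G (labeled T I \<delta>)) {1..m} \<delta>"

text \<open>Only meaningful for multisamples that have exactly one compression set.\<close>

definition compression_set ::
    "'a set \<Rightarrow> (('a \<times> nat) list \<Rightarrow> 'a set) \<Rightarrow> nat \<Rightarrow> nat \<Rightarrow> (nat \<Rightarrow> 'a) \<Rightarrow> nat set" where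
  "compression_set T G d m \<delta> = (THE I. is_compression_set T G d m \<delta> I)"

definition error_event ::
    "'a measure \<Rightarrow> 'a set \<Rightarrow> (nat \<Rightarrow> ('a \<times> nat) list \<Rightarrow> 'a set) \<Rightarrow> nat \<Rightarrow> real \<Rightarrow> (nat \<Rightarrow> 'a) set" where
  "error_event M T A m \<epsilon> =
     {\<delta> \<in> space (sample_space M m). error M T (A m (labeled T {1..m} \<delta>)) > \<epsilon>}"

text \<open>
  The algorithm is the family \<open>A m\<close>, \<open>m \<ge> m0\<close>; other values of \<open>A\<close> are irrelevant.  Measurability
  of the error event is part of the definition because \<^const>\<open>measure\<close> is \<open>0\<close> on sets that are not
  measurable.
\<close>

definition PAC_T ::
    "'a measure \<Rightarrow> 'a set \<Rightarrow> nat \<Rightarrow> (nat \<Rightarrow> ('a \<times> nat) list \<Rightarrow> 'a set) \<Rightarrow> (nat \<Rightarrow> real \<Rightarrow> real) \<Rightarrow> bool" where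
  "PAC_T M T m0 A q \<longleftrightarrow>
     (\<forall>m\<ge>m0. A m \<in> labeled_tuples M m \<rightarrow> sets M) \<and>
     (\<forall>m\<ge>1. \<forall>\<epsilon>\<in>{0<..<1}. q m \<epsilon> \<in> {0..1}) \<and>
     (\<forall>\<epsilon>\<in>{0<..<1}. (\<lambda>m. q m \<epsilon>) \<longlonglongrightarrow> 0) \<and>
     (\<forall>\<epsilon>\<in>{0<..<1}. \<forall>m\<ge>m0.
        error_event M T A m \<epsilon> \<in> sets (sample_space M m) \<and>
        measure (sample_space M m) (error_event M T A m \<epsilon>) \<le> q m \<epsilon>)"

end

theory Submission
  imports Defs
begin

text \<open>
  Let \<open>V\<close> be the error of the hypothesis that \<open>G\<close> returns on \<open>d\<close> samples.  By Fubini, a given set of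
  \<open>d\<close> indices is a compression set of an \<open>m\<close>-multisample with probability \<open>E (1 - V)\<^sup>m\<^sup>-\<^sup>d\<close>, and almost
  surely exactly one of the \<open>m choose d\<close> candidates is.  Hence \<open>(m choose d) E (1 - V)\<^sup>m\<^sup>-\<^sup>d = 1\<close> for all
  \<open>m \<ge> d\<close>, which prescribes all moments of \<open>1 - V\<close>; since its law lives on \<open>[0, 1]\<close>, it must have the
  density \<open>d (1 - x)\<^sup>d\<^sup>-\<^sup>1\<close>.  The error probability is then an incomplete beta integral, and the
  binomial sum is an antiderivative of its integrand.
\<close>

section \<open>Binomial tails: derivative, range and limit\<close>

text \<open>The derivative telescopes: differentiating the \<open>1 - x\<close> factor of each new
  term cancels the derivative of the sum so far, and differentiating its \<open>x\<close> factor
  yields the next one.\<close>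

lemma binomial_tail_has_derivative:
  fixes x :: real
  assumes "d \<le> m"
  shows "((\<lambda>x. \<Sum>i<d. real (m choose i) * (1 - x) ^ i * x ^ (m - i)) has_real_derivative
    real (m choose d) * (real d * (1 - x) ^ (d - 1) * x ^ (m - d))) (at x)"
  using assms
proof (induction d)
  case 0
  then show ?case by simp
next
  case (Suc d)
  \<comment> \<open>Both sides equal \<open>m * ((m - 1) choose d)\<close>; this puts the surviving
    term into the form claimed for \<open>Suc d\<close>.\<close>
  have *: "real (m choose d) * real (m - d) = real (m choose Suc d) * real (Suc d)"
    using binomial_absorb_comp[of m d] binomial_absorption[of d m] Suc.prems
    by (metis mult.commute of_nat_mult)
  have "((\<lambda>x. (\<Sum>i<d. real (m choose i) * (1 - x) ^ i * x ^ (m - i))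
        + real (m choose d) * (1 - x) ^ d * x ^ (m - d)) has_real_derivative
      real (m choose d) * (real d * (1 - x) ^ (d - 1) * x ^ (m - d))
      + (real (m choose d) * (- (real d * (1 - x) ^ (d - 1))) * x ^ (m - d)
        + real (m choose d) * (1 - x) ^ d * (real (m - d) * x ^ (m - d - 1)))) (at x)"
    using Suc by (intro DERIV_add) (auto intro!: derivative_eq_intros)
  moreover have "real (m choose d) * (real d * (1 - x) ^ (d - 1) * x ^ (m - d))
      + (real (m choose d) * (- (real d * (1 - x) ^ (d - 1))) * x ^ (m - d)
        + real (m choose d) * (1 - x) ^ d * (real (m - d) * x ^ (m - d - 1)))
      = (real (m choose d) * real (m - d)) * (1 - x) ^ d * x ^ (m - Suc d)"
    by (simp add: algebra_simps)
  moreover have "\<dots> = real (m choose Suc d) * (real (Suc d) * (1 - x) ^ (Suc d - 1) * x ^ (m - Suc d))"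
    unfolding * by simp
  ultimately show ?case
    by (simp only: sum.lessThan_Suc)
qed

lemma binomial_tail_in_unit:
  fixes \<epsilon> :: real
  assumes "0 \<le> \<epsilon>" "\<epsilon> \<le> 1"
  shows "(\<Sum>i<d. real (m choose i) * \<epsilon> ^ i * (1 - \<epsilon>) ^ (m - i)) \<in> {0..1}"
proof -
  let ?t = "\<lambda>i. real (m choose i) * \<epsilon> ^ i * (1 - \<epsilon>) ^ (m - i)"
  have nonneg: "0 \<le> ?t i" for i
    using assms by auto
  \<comment> \<open>The union covers the case that the tail runs past \<open>m\<close>, which
    matters because \<open>PAC_T\<close> bounds \<open>q\<close> also for \<open>m < d\<close>.
    Terms with \<open>i > m\<close> vanish.\<close>
  have "(\<Sum>i<d. ?t i) \<le> (\<Sum>i\<in>{..<d} \<union> {..m}. ?t i)"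
    using nonneg by (intro sum_mono2) auto
  also have "\<dots> = (\<Sum>i\<le>m. ?t i)"
    by (intro sum.mono_neutral_right) auto
  also have "\<dots> = (\<epsilon> + (1 - \<epsilon>)) ^ m"
    by (simp only: binomial_ring)
  finally show ?thesis
    using nonneg by (auto intro!: sum_nonneg)
qed

lemma power_times_geometric_tendsto_0:
  fixes c :: real
  assumes "0 \<le> c" "c < 1"
  shows "(\<lambda>n. real n ^ i * c ^ n) \<longlonglongrightarrow> 0"
proof -
  \<comment> \<open>Splitting \<open>c\<close> as \<open>s ^ Suc i\<close> gives each of the
    \<open>i\<close> factors \<open>n\<close> a decaying factor of its own; the spare
    \<open>s ^ n\<close> forces the limit \<open>0\<close> even for \<open>i = 0\<close>.\<close>
  define s where "s = root (Suc i) c"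
  have s: "0 \<le> s" "s < 1" "s ^ Suc i = c"
    using assms by (simp_all add: s_def del: power_Suc)
  have "(\<lambda>n. (real n * s ^ n) ^ i * s ^ n) \<longlonglongrightarrow> 0 ^ i * 0"
    using s powser_times_n_limit_0[of s]
    by (intro tendsto_mult tendsto_power LIMSEQ_power_zero) auto
  moreover have "(real n * s ^ n) ^ i * s ^ n = real n ^ i * c ^ n" for n
    unfolding s(3)[symmetric] by (simp add: power_mult_distrib power_commutes flip: power_mult)
      (simp add: mult.commute power_mult flip: power_add)
  ultimately show ?thesis by simp
qed

text \<open>For fixed \<open>i\<close> the binomial coefficient grows at most like
  \<open>m ^ i\<close>, which the geometric factor beats. The bound is claimed only for
  \<open>i \<le> m\<close>, where \<open>m - i\<close> is not truncated; this holds
  eventually.\<close>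

lemma binomial_term_tendsto_0:
  fixes \<epsilon> :: real
  assumes "0 < \<epsilon>" "\<epsilon> < 1"
  shows "(\<lambda>m. real (m choose i) * \<epsilon> ^ i * (1 - \<epsilon>) ^ (m - i)) \<longlonglongrightarrow> 0"
proof (rule tendsto_sandwich[OF _ _ tendsto_const])
  have "real (m choose i) * \<epsilon> ^ i * (1 - \<epsilon>) ^ (m - i)
      \<le> (real m ^ i * (1 - \<epsilon>) ^ m) * (\<epsilon> ^ i / (1 - \<epsilon>) ^ i)" if "i \<le> m" for m
  proof -
    have "real (m choose i) \<le> real m ^ i"
      using that by (metis binomial_le_pow of_nat_le_iff of_nat_power)
    then have "real (m choose i) * (\<epsilon> ^ i * (1 - \<epsilon>) ^ (m - i))
        \<le> real m ^ i * (\<epsilon> ^ i * (1 - \<epsilon>) ^ (m - i))"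
      using assms by (intro mult_right_mono) auto
    then show ?thesis
      using assms that by (simp add: power_diff mult_ac)
  qed
  then show "\<forall>\<^sub>F m in sequentially. real (m choose i) * \<epsilon> ^ i * (1 - \<epsilon>) ^ (m - i)
      \<le> (real m ^ i * (1 - \<epsilon>) ^ m) * (\<epsilon> ^ i / (1 - \<epsilon>) ^ i)"
    unfolding eventually_sequentially by blast
  have "(\<lambda>m. real m ^ i * (1 - \<epsilon>) ^ m) \<longlonglongrightarrow> 0"
    using assms by (intro power_times_geometric_tendsto_0) auto
  then show "(\<lambda>m. (real m ^ i * (1 - \<epsilon>) ^ m) * (\<epsilon> ^ i / (1 - \<epsilon>) ^ i)) \<longlonglongrightarrow> 0"
    by (rule tendsto_mult_left_zero)
qed (use assms in auto)

section \<open>Laws on the unit interval are determined by their moments\<close>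

text \<open>The Taylor polynomials of the characteristic function have coefficients given by the
  moments and converge to it because the law is bounded, so equal moments give equal characteristic
  functions and Levy uniqueness applies. Moments are nonnegative integrals here because Fubini
  delivers them in this form.\<close>

lemma real_distribution_eqI_moments:
  fixes M1 M2 :: "real measure"
  assumes M1: "real_distribution M1" "AE x in M1. x \<in> {0..1}"
    and M2: "real_distribution M2" "AE x in M2. x \<in> {0..1}"
    and moments: "\<And>k. (\<integral>\<^sup>+x. ennreal (x ^ k) \<partial>M1) = (\<integral>\<^sup>+x. ennreal (x ^ k) \<partial>M2)"
  shows "M1 = M2"
proof -
  have approx: "cmod (char N t - (\<Sum>k\<le>n. ((\<i> * t) ^ k / fact k) *
        enn2real (\<integral>\<^sup>+x. ennreal (x ^ k) \<partial>N))) \<le> 2 * \<bar>t\<bar> ^ n / fact n"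
    if N: "real_distribution N" "AE x in N. x \<in> {0..1}" for N and t :: real and n
  proof -
    interpret N: real_distribution N by fact
    have int: "integrable N (\<lambda>x. x ^ k)" for k
      by (intro N.integrable_const_bound[of _ 1] eventually_mono[OF N(2)])
        (auto simp: power_abs power_le_one)
    have eq: "(\<integral>x. x ^ k \<partial>N) = enn2real (\<integral>\<^sup>+x. ennreal (x ^ k) \<partial>N)" for k
      using N(2) by (intro integral_eq_nn_integral) auto
    \<comment> \<open>On \<open>[0, 1]\<close> absolute moments are at most \<open>1\<close>, so the
      Taylor remainder is bounded independently of the law.\<close>
    have "N.expectation (\<lambda>x. \<bar>x\<bar> ^ n) \<le> N.expectation (\<lambda>x. 1)"
      using N(2) int by (intro integral_mono_AE)
        (auto simp: power_abs[symmetric] power_le_one intro!: integrable_abs elim!: AE_mp)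
    then have "N.expectation (\<lambda>x. \<bar>x\<bar> ^ n) \<le> 1"
      using N.prob_space by simp
    then have "(2 * \<bar>t\<bar> ^ n / fact n) * N.expectation (\<lambda>x. \<bar>x\<bar> ^ n) \<le> (2 * \<bar>t\<bar> ^ n / fact n) * 1"
      by (intro mult_left_mono) auto
    then show ?thesis
      using N.char_approx1[of n t, OF int] by (simp add: eq)
  qed
  have "char M1 t = char M2 t" for t
  proof -
    have "cmod (char M1 t - char M2 t) \<le> 4 * (\<bar>t\<bar> ^ n / fact n)" for n
    proof -
      \<comment> \<open>By equality of moments, \<open>?s\<close> is the Taylor polynomial of both
        characteristic functions.\<close>
      let ?s = "\<Sum>k\<le>n. ((\<i> * t) ^ k / fact k) * enn2real (\<integral>\<^sup>+x. ennreal (x ^ k) \<partial>M2)"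
      have "cmod (char M1 t - char M2 t) \<le> cmod (char M1 t - ?s) + cmod (char M2 t - ?s)"
        using norm_triangle_ineq4[of "char M1 t - ?s" "char M2 t - ?s"] by simp
      then show ?thesis
        using approx[OF M1, of t n] approx[OF M2, of t n] unfolding moments by simp
    qed
    moreover have "(\<lambda>n. 4 * (\<bar>t\<bar> ^ n / fact n)) \<longlonglongrightarrow> 0"
      using power_tendsto_0_iff summable_LIMSEQ_zero[OF summable_exp[of "\<bar>t\<bar>"]]
      by (intro tendsto_mult_right_zero) (simp add: field_simps)
    ultimately have "cmod (char M1 t - char M2 t) \<le> 0"
      by (intro LIMSEQ_le_const) auto
    then show ?thesis by simp
  qed
  then show ?thesis
    using Levy_uniqueness M1(1) M2(1) by blast
qed

section \<open>The beta law and its incomplete moments\<close>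

text \<open>For \<open>d \<ge> 1\<close> this is the Beta distribution with parameters
  \<open>1\<close> and \<open>d\<close>, the law of the minimum of \<open>d\<close> independent
  uniform variables on \<open>[0, 1]\<close>.\<close>

definition beta_law :: "nat \<Rightarrow> real measure" where
  "beta_law d = density lborel (\<lambda>x. ennreal (real d * (1 - x) ^ (d - 1)) * indicator {0..1} x)"

lemma sets_beta_law [measurable_cong, simp]: "sets (beta_law d) = sets borel"
  and space_beta_law [simp]: "space (beta_law d) = UNIV"
  by (simp_all add: beta_law_def)

lemma AE_beta_law: "AE x in beta_law d. x \<in> {0..1}"
  unfolding beta_law_def by (subst AE_density) (auto split: split_indicator)

lemma AE_beta_law_neq: "AE x in beta_law d. x \<noteq> a"
  unfolding beta_law_def using AE_lborel_singleton[of a] by (subst AE_density) auto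

text \<open>Density, power and binomial coefficient multiply to exactly the derivative in
  \<open>binomial_tail_has_derivative\<close>, so the fundamental theorem of calculus evaluates the
  integral.\<close>

lemma nn_integral_beta_law_atMost:
  assumes "1 \<le> d" "d \<le> m" "0 \<le> a" "a \<le> 1"
  shows "of_nat (m choose d) * (\<integral>\<^sup>+x. ennreal (x ^ (m - d)) * indicator {..a} x \<partial>beta_law d)
    = ennreal (\<Sum>i<d. real (m choose i) * (1 - a) ^ i * a ^ (m - i))"
proof -
  let ?F = "\<lambda>x::real. \<Sum>i<d. real (m choose i) * (1 - x) ^ i * x ^ (m - i)"
  have "of_nat (m choose d) * (\<integral>\<^sup>+x. ennreal (x ^ (m - d)) * indicator {..a} x \<partial>beta_law d)
      = (\<integral>\<^sup>+x. of_nat (m choose d) * (ennreal (real d * (1 - x) ^ (d - 1)) * indicator {0..1} x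
          * (ennreal (x ^ (m - d)) * indicator {..a} x)) \<partial>lborel)"
    unfolding beta_law_def by (subst nn_integral_density) (auto simp: nn_integral_cmult)
  also have "\<dots> = (\<integral>\<^sup>+x. ennreal (real (m choose d) * (real d * (1 - x) ^ (d - 1) * x ^ (m - d)))
      * indicator {0..a} x \<partial>lborel)"
    using assms by (intro nn_integral_cong)
      (auto simp: ennreal_mult' ennreal_of_nat_eq_real_of_nat mult_ac split: split_indicator)
  also have "\<dots> = ennreal (?F a - ?F 0)"
    using assms binomial_tail_has_derivative[OF assms(2)] by (intro nn_integral_FTC_Icc) auto
  \<comment> \<open>Every exponent \<open>m - i\<close> is positive, since
    \<open>i < d \<le> m\<close>.\<close>
  also have "?F 0 = 0"
    using assms by (intro sum.neutral) auto
  finally show ?thesis by simp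
qed

lemma nn_integral_beta_law_moment:
  assumes "1 \<le> d" "d \<le> m"
  shows "of_nat (m choose d) * (\<integral>\<^sup>+x. ennreal (x ^ (m - d)) \<partial>beta_law d) = 1"
proof -
  have "(\<integral>\<^sup>+x. ennreal (x ^ (m - d)) \<partial>beta_law d)
      = (\<integral>\<^sup>+x. ennreal (x ^ (m - d)) * indicator {..1} x \<partial>beta_law d)"
    by (intro nn_integral_cong_AE eventually_mono[OF AE_beta_law]) auto
  \<comment> \<open>Only the summand \<open>i = 0\<close> survives, by
    \<open>0 ^ 0 = 1\<close>.\<close>
  moreover have "(\<Sum>i<d. real (m choose i) * (1 - 1) ^ i * 1 ^ (m - i)) = 1"
    using assms by (cases d) (auto simp: sum.lessThan_Suc_shift)
  ultimately show ?thesis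
    using nn_integral_beta_law_atMost[OF assms, of 1] by simp
qed

lemma real_distribution_beta_law:
  assumes "1 \<le> d"
  shows "real_distribution (beta_law d)"
proof -
  have "prob_space (beta_law d)"
    \<comment> \<open>The total mass is the moment formula at \<open>m = d\<close>.\<close>
    using nn_integral_beta_law_moment[OF assms order_refl] by (intro prob_spaceI) simp
  then show ?thesis
    by (simp add: real_distribution_def real_distribution_axioms_def)
qed

text \<open>Taking \<open>m = d + k\<close>, the hypothesis fixes the \<open>k\<close>-th moment as
  the reciprocal of \<open>(d + k) choose d\<close>, which is also that of
  \<open>beta_law d\<close>.\<close>

lemma eq_beta_lawI:
  assumes "1 \<le> d" "real_distribution N" "AE x in N. x \<in> {0..1}"
    and moments: "\<And>m. d \<le> m \<Longrightarrow> of_nat (m choose d) * (\<integral>\<^sup>+x. ennreal (x ^ (m - d)) \<partial>N) = 1"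
  shows "N = beta_law d"
proof (rule real_distribution_eqI_moments)
  fix k
  let ?c = "of_nat ((d + k) choose d) :: ennreal"
  have "?c * (\<integral>\<^sup>+x. ennreal (x ^ k) \<partial>N) = ?c * (\<integral>\<^sup>+x. ennreal (x ^ k) \<partial>beta_law d)"
    using moments[of "d + k"] nn_integral_beta_law_moment[of d "d + k"] assms(1) by simp
  moreover have "?c \<noteq> 0" "?c \<noteq> \<top>"
    by (auto simp: of_nat_eq_0_iff)
  ultimately show "(\<integral>\<^sup>+x. ennreal (x ^ k) \<partial>N) = (\<integral>\<^sup>+x. ennreal (x ^ k) \<partial>beta_law d)"
    by (simp add: ennreal_mult_cancel_left)
qed (use assms AE_beta_law real_distribution_beta_law in auto)

section \<open>Compression schemes and renumbering of samples\<close>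

declare One_nat_def [simp del]

text \<open>\<open>labeled\<close> keeps only the ordered labeled points, so \<open>G\<close> cannot
  tell a sample indexed by \<open>I\<close> from its renumbering by \<open>{1..d}\<close>. Samples
  are numbered from \<open>1\<close> and list positions from \<open>0\<close>, hence
  \<open>k - 1\<close>.\<close>

lemma labeled_reindex:
  assumes "finite I" "card I = d"
  shows "labeled T {1..d} (\<lambda>k\<in>{1..d}. \<delta> (sorted_list_of_set I ! (k - 1))) = labeled T I \<delta>"
proof -
  have "sorted_list_of_set {1..d} = [1..<Suc d]"
    by (metis atLeastLessThanSuc_atLeastAtMost sorted_list_of_set_range)
  then show ?thesis
    unfolding labeled_def using assms by (intro nth_equalityI) (auto simp del: upt_Suc)
qed

text \<open>The hypotheses on \<open>G\<close> alone, without the algorithm. Measurability of the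
  error on \<open>d\<close> samples is an assumption here; \<open>theorem3\<close> derives it from
  the error events of \<open>A\<close> at \<open>m = d\<close>.\<close>

locale compression_scheme = prob_space M for M :: "'a measure" +
  fixes T :: "'a set"
    and d :: nat
    and G :: "('a \<times> nat) list \<Rightarrow> 'a set"
  assumes T_sets: "T \<in> sets M"
    and d_pos: "d \<ge> 1"
    and G_sets: "G \<in> labeled_tuples M d \<rightarrow> sets M"
    and G_consistent: "\<And>m I \<delta>. m \<ge> d \<Longrightarrow> I \<in> index_sets d m \<Longrightarrow> \<delta> \<in> space (sample_space M m) \<Longrightarrow>
          consistent T (G (labeled T I \<delta>)) I \<delta>"
    and G_unique: "\<And>m. m \<ge> d \<Longrightarrow>
          (AE \<delta> in sample_space M m. \<exists>!I. is_compression_set T G d m \<delta> I)"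
    and consistency_measurable: "\<And>m I. m \<ge> d \<Longrightarrow> I \<in> index_sets d m \<Longrightarrow>
          {\<delta> \<in> space (sample_space M m). consistent T (G (labeled T I \<delta>)) {1..m} \<delta>}
            \<in> sets (sample_space M m)"
    and error_G_measurable:
      "(\<lambda>\<delta>. error M T (G (labeled T {1..d} \<delta>))) \<in> borel_measurable (sample_space M d)"
begin

abbreviation V :: "(nat \<Rightarrow> 'a) \<Rightarrow> real" where
  "V \<delta> \<equiv> error M T (G (labeled T {1..d} \<delta>))"

abbreviation reindex :: "nat set \<Rightarrow> (nat \<Rightarrow> 'a) \<Rightarrow> nat \<Rightarrow> 'a" where
  "reindex I \<delta> \<equiv> \<lambda>k\<in>{1..d}. \<delta> (sorted_list_of_set I ! (k - 1))"

lemma index_setsD: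
  assumes "I \<in> index_sets d m"
  shows "finite I" "I \<subseteq> {1..m}" "card I = d"
  using assms by (auto simp: index_sets_def intro: finite_subset)

lemma finite_index_sets: "finite (index_sets d m)"
  and card_index_sets: "card (index_sets d m) = m choose d"
  using n_subsets[of "{1..m}" d] by (auto simp: index_sets_def)

lemma nth_in_index_set:
  assumes "finite I" "card I = d" "k \<in> {1..d}"
  shows "sorted_list_of_set I ! (k - 1) \<in> I"
  using assms nth_mem[of "k - 1" "sorted_list_of_set I"] by auto

lemma reindex_measurable:
  assumes "finite I" "card I = d" "I \<subseteq> K"
  shows "reindex I \<in> Pi\<^sub>M K (\<lambda>_. M) \<rightarrow>\<^sub>M sample_space M d"
  using assms nth_in_index_set by (intro measurable_restrict measurable_component_singleton) blast

text \<open>The renumbering is injective, so it picks \<open>d\<close> distinct coordinates, which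
  are again independent with law \<open>M\<close>.\<close>

lemma distr_reindex:
  assumes "finite I" "card I = d"
  shows "distr (Pi\<^sub>M I (\<lambda>_. M)) (sample_space M d) (reindex I) = sample_space M d"
proof (rule distr_PiM_reindex)
  show "inj_on (\<lambda>k. sorted_list_of_set I ! (k - 1)) {1..d}"
  proof (rule inj_onI)
    fix k l assume "k \<in> {1..d}" "l \<in> {1..d}"
      and "sorted_list_of_set I ! (k - 1) = sorted_list_of_set I ! (l - 1)"
    then have "k - 1 = l - 1"
      using assms by (subst (asm) nth_eq_iff_index_eq) auto
    then show "k = l"
      using \<open>k \<in> {1..d}\<close> \<open>l \<in> {1..d}\<close> by auto
  qed
qed (use nth_in_index_set[OF assms] prob_space_axioms in auto)

lemma V_reindex:
  assumes "finite I" "card I = d"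
  shows "V (reindex I \<delta>) = error M T (G (labeled T I \<delta>))"
  unfolding labeled_reindex[OF assms, of T \<delta>] ..

lemma G_labeled_sets:
  assumes "finite I" "card I = d" "\<delta> \<in> space (Pi\<^sub>M K (\<lambda>_. M))" "I \<subseteq> K"
  shows "G (labeled T I \<delta>) \<in> sets M"
  using assms by (intro funcset_mem[OF G_sets])
    (fastforce simp: labeled_tuples_def labeled_def space_PiM indicator_def)

lemma labeled_cong:
  assumes "\<And>i. i \<in> I \<Longrightarrow> \<delta> i = \<delta>' i" "finite I"
  shows "labeled T I \<delta> = labeled T I \<delta>'"
  using assms by (simp add: labeled_def)

lemma error_in_unit: "error M T H \<in> {0..1}"
  by (simp add: error_def)

lemma agreement_measurable:
  assumes "H \<in> sets M"
  shows "{x \<in> space M. (indicator H x :: nat) = indicator T x} \<in> sets M"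
proof -
  have "{x \<in> space M. (indicator H x :: nat) = indicator T x}
      = (H \<inter> T) \<union> ((space M - H) \<inter> (space M - T))"
    using sets.sets_into_space[OF assms] sets.sets_into_space[OF T_sets]
    by (auto simp: indicator_def)
  then show ?thesis
    using assms T_sets by auto
qed

lemma emeasure_agreement:
  assumes "H \<in> sets M"
  shows "emeasure M {x \<in> space M. (indicator H x :: nat) = indicator T x} = ennreal (1 - error M T H)"
proof -
  let ?S = "{x \<in> space M. (indicator H x :: nat) = indicator T x}"
  have "error M T H = prob (space M - ?S)"
    unfolding error_def by (rule arg_cong[where f = prob]) auto
  then have "prob ?S = 1 - error M T H"
    using prob_compl[OF agreement_measurable[OF assms]] by simp
  then show ?thesis
    by (simp add: emeasure_eq_measure)
qed

section \<open>Integration over the event that a given index set compresses the sample\<close>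

text \<open>Renumbering reduces the error of the hypothesis for \<open>I\<close> to
  \<open>V\<close>. The test function \<open>g\<close> is kept general because the constant
  \<open>1\<close> will give the moments and the indicator of \<open>{\<epsilon><..}\<close> the
  tail.\<close>

lemma compression_integrand_measurable:
  fixes g :: "real \<Rightarrow> ennreal"
  assumes m: "d \<le> m" and I: "I \<in> index_sets d m" and g: "g \<in> borel_measurable borel"
  shows "(\<lambda>\<delta>. indicator {\<delta> \<in> space (sample_space M m).
        consistent T (G (labeled T I \<delta>)) {1..m} \<delta>} \<delta> * g (error M T (G (labeled T I \<delta>))))
    \<in> borel_measurable (sample_space M m)"
proof -
  note I' = index_setsD[OF I]
  have "(\<lambda>\<delta>. error M T (G (labeled T I \<delta>))) \<in> borel_measurable (sample_space M m)"
    using measurable_compose[OF reindex_measurable[OF I'(1,3,2)] error_G_measurable]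
    by (simp only: V_reindex[OF I'(1,3)])
  then show ?thesis
    using consistency_measurable[OF m I]
    by (intro borel_measurable_times_ennreal borel_measurable_indicator
      measurable_compose[OF _ g]) auto
qed

text \<open>
  Conditionally on the samples indexed by \<open>I\<close>, the hypothesis \<open>H\<^sub>I\<close> is fixed and agrees with \<open>T\<close>
  on each of the \<open>m - d\<close> independent remaining samples with probability \<open>1 - V\<close>.
\<close>

lemma nn_integral_compression:
  fixes g :: "real \<Rightarrow> ennreal"
  assumes m: "d \<le> m" and I: "I \<in> index_sets d m" and g [measurable]: "g \<in> borel_measurable borel"
  shows "(\<integral>\<^sup>+\<delta>. indicator {\<delta> \<in> space (sample_space M m).
        consistent T (G (labeled T I \<delta>)) {1..m} \<delta>} \<delta> * g (error M T (G (labeled T I \<delta>)))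
        \<partial>sample_space M m)
    = (\<integral>\<^sup>+\<delta>. ennreal ((1 - V \<delta>) ^ (m - d)) * g (V \<delta>) \<partial>sample_space M d)"
proof -
  interpret product_sigma_finite "\<lambda>_::nat. M"
    by unfold_locales
  note [measurable] = error_G_measurable
  define J where "J = {1..m} - I"
  let ?C = "{\<delta> \<in> space (sample_space M m). consistent T (G (labeled T I \<delta>)) {1..m} \<delta>}"
  let ?f = "\<lambda>\<delta>. indicator ?C \<delta> * g (error M T (G (labeled T I \<delta>)))"
  note I' = index_setsD[OF I]
  have IJ: "I \<inter> J = {}" "finite J" "I \<union> J = {1..m}" and card_J: "card J = m - d"
    using I' by (auto simp: J_def card_Diff_subset)
  note V_reindex = V_reindex[OF I'(1,3)]
  have inner: "(\<integral>\<^sup>+y. ?f (merge I J (x, y)) \<partial>Pi\<^sub>M J (\<lambda>_. M))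
      = ennreal ((1 - V (reindex I x)) ^ (m - d)) * g (V (reindex I x))"
    if x: "x \<in> space (Pi\<^sub>M I (\<lambda>_. M))" for x
  proof -
    define H where "H = G (labeled T I x)"
    define S where "S = {z \<in> space M. (indicator H z :: nat) = indicator T z}"
    have H: "H \<in> sets M"
      unfolding H_def using G_labeled_sets I' x by blast
    have S [measurable]: "S \<in> sets M"
      unfolding S_def using agreement_measurable[OF H] .
    have "?f (merge I J (x, y)) = indicator (\<Pi>\<^sub>E i\<in>J. S) y * g (error M T H)"
      if y: "y \<in> space (Pi\<^sub>M J (\<lambda>_. M))" for y
    proof -
      let ?z = "merge I J (x, y)"
      have z: "?z \<in> space (sample_space M m)"
        using x y IJ unfolding IJ(3)[symmetric] by (auto simp: space_PiM PiE_iff merge_def extensional_def)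
      have lab: "labeled T I ?z = labeled T I x"
        using I' by (intro labeled_cong) (auto simp: merge_def)
      \<comment> \<open>Agreement on \<open>I\<close> is automatic, so consistency with the whole
        sample constrains only the coordinates in \<open>J\<close>, each separately: it is a
        box.\<close>
      have "consistent T H I ?z"
        using G_consistent[OF m I z] lab by (simp add: H_def)
      then have "consistent T H {1..m} ?z \<longleftrightarrow> (\<forall>i\<in>J. (indicator H (y i) :: nat) = indicator T (y i))"
        unfolding consistent_def IJ(3)[symmetric] using IJ(1) by (auto simp: ball_Un merge_def)
      also have "\<dots> \<longleftrightarrow> y \<in> (\<Pi>\<^sub>E i\<in>J. S)"
        using y by (auto simp: S_def space_PiM PiE_iff)
      finally show ?thesis
        using z lab by (simp add: H_def indicator_def)
    qed
    then have "(\<integral>\<^sup>+y. ?f (merge I J (x, y)) \<partial>Pi\<^sub>M J (\<lambda>_. M))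
        = (\<integral>\<^sup>+y. indicator (\<Pi>\<^sub>E i\<in>J. S) y * g (error M T H) \<partial>Pi\<^sub>M J (\<lambda>_. M))"
      by (intro nn_integral_cong)
    also have "\<dots> = emeasure (Pi\<^sub>M J (\<lambda>_. M)) (\<Pi>\<^sub>E i\<in>J. S) * g (error M T H)"
      using IJ by (subst nn_integral_multc) (auto intro!: sets_PiM_I_finite borel_measurable_indicator)
    also have "emeasure (Pi\<^sub>M J (\<lambda>_. M)) (\<Pi>\<^sub>E i\<in>J. S) = ennreal (1 - error M T H) ^ (m - d)"
      using IJ card_J emeasure_agreement[OF H] by (subst emeasure_PiM) (auto simp: S_def[symmetric])
    also have "\<dots> = ennreal ((1 - error M T H) ^ (m - d))"
      using error_in_unit[of H] by (intro ennreal_power) auto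
    finally show ?thesis
      using V_reindex by (simp add: H_def)
  qed
  have "(\<integral>\<^sup>+\<delta>. ?f \<delta> \<partial>sample_space M m)
      = (\<integral>\<^sup>+x. (\<integral>\<^sup>+y. ?f (merge I J (x, y)) \<partial>Pi\<^sub>M J (\<lambda>_. M)) \<partial>Pi\<^sub>M I (\<lambda>_. M))"
    using product_nn_integral_fold[OF IJ(1) I'(1) IJ(2), of ?f]
      compression_integrand_measurable[OF m I g] by (simp only: IJ(3))
  also have "\<dots> = (\<integral>\<^sup>+x. ennreal ((1 - V (reindex I x)) ^ (m - d)) * g (V (reindex I x))
      \<partial>Pi\<^sub>M I (\<lambda>_. M))"
    by (intro nn_integral_cong inner)
  \<comment> \<open>The integrand depends on \<open>x\<close> only through its renumbering, so the
    value is the same for every \<open>I\<close>.\<close>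
  also have "\<dots> = (\<integral>\<^sup>+\<delta>. ennreal ((1 - V \<delta>) ^ (m - d)) * g (V \<delta>)
      \<partial>distr (Pi\<^sub>M I (\<lambda>_. M)) (sample_space M d) (reindex I))"
    using reindex_measurable[OF I'(1,3) order_refl] by (subst nn_integral_distr) auto
  finally show ?thesis
    by (simp only: distr_reindex[OF I'(1,3)])
qed

text \<open>Almost surely exactly one indicator in the sum over all index sets is nonzero, and it
  selects the compression set; the \<open>m choose d\<close> summands have equal integrals. Where
  uniqueness fails, \<open>compression_set\<close> is unspecified, but only on a null set.\<close>

lemma nn_integral_hypothesis_error:
  fixes g :: "real \<Rightarrow> ennreal"
  assumes m: "d \<le> m" and g [measurable]: "g \<in> borel_measurable borel"
  shows "(\<integral>\<^sup>+\<delta>. g (error M T (G (labeled T (compression_set T G d m \<delta>) \<delta>))) \<partial>sample_space M m)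
    = of_nat (m choose d) * (\<integral>\<^sup>+\<delta>. ennreal ((1 - V \<delta>) ^ (m - d)) * g (V \<delta>) \<partial>sample_space M d)"
proof -
  let ?C = "\<lambda>I. {\<delta> \<in> space (sample_space M m). consistent T (G (labeled T I \<delta>)) {1..m} \<delta>}"
  let ?f = "\<lambda>I \<delta>. indicator (?C I) \<delta> * g (error M T (G (labeled T I \<delta>)))"
  have "g (error M T (G (labeled T (compression_set T G d m \<delta>) \<delta>))) = (\<Sum>I\<in>index_sets d m. ?f I \<delta>)"
    if \<delta>: "\<delta> \<in> space (sample_space M m)" and unique: "\<exists>!I. is_compression_set T G d m \<delta> I" for \<delta>
  proof -
    let ?I = "compression_set T G d m \<delta>"
    have I: "is_compression_set T G d m \<delta> ?I"
      unfolding compression_set_def using unique by (rule theI')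
    then have "?I \<in> index_sets d m" "\<delta> \<in> ?C ?I"
      using \<delta> by (auto simp: is_compression_set_def)
    moreover have "?f I' \<delta> = 0" if "I' \<in> index_sets d m - {?I}" for I'
      using that unique I by (auto simp: is_compression_set_def indicator_def)
    ultimately have "(\<Sum>I\<in>index_sets d m. ?f I \<delta>) = ?f ?I \<delta> + 0"
      unfolding sum.remove[OF finite_index_sets \<open>?I \<in> index_sets d m\<close>]
      by (intro arg_cong2[where f = "(+)"] sum.neutral) blast+
    then show ?thesis
      using \<open>\<delta> \<in> ?C ?I\<close> by simp
  qed
  then have "(\<integral>\<^sup>+\<delta>. g (error M T (G (labeled T (compression_set T G d m \<delta>) \<delta>))) \<partial>sample_space M m)
      = (\<integral>\<^sup>+\<delta>. (\<Sum>I\<in>index_sets d m. ?f I \<delta>) \<partial>sample_space M m)"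
    using G_unique[OF m] AE_space by (intro nn_integral_cong_AE) (auto elim: AE_mp)
  also have "\<dots> = (\<Sum>I\<in>index_sets d m. \<integral>\<^sup>+\<delta>. ?f I \<delta> \<partial>sample_space M m)"
    using compression_integrand_measurable[OF m _ g] by (intro nn_integral_sum)
  also have "\<dots> = (\<Sum>I\<in>index_sets d m. \<integral>\<^sup>+\<delta>. ennreal ((1 - V \<delta>) ^ (m - d)) * g (V \<delta>) \<partial>sample_space M d)"
    using nn_integral_compression[OF m _ g] by (intro sum.cong) auto
  finally show ?thesis
    by (simp add: card_index_sets)
qed

section \<open>The law of the error\<close>

lemma distr_accuracy: "distr (sample_space M d) borel (\<lambda>\<delta>. 1 - V \<delta>) = beta_law d"
proof (rule eq_beta_lawI[OF d_pos])
  note [measurable] = error_G_measurable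
  have prob_PiM: "prob_space (sample_space M m)" for m
    by (intro prob_space_PiM prob_space_axioms)
  interpret D: prob_space "sample_space M d" by (rule prob_PiM)
  show "real_distribution (distr (sample_space M d) borel (\<lambda>\<delta>. 1 - V \<delta>))"
    by (rule D.real_distribution_distr) measurable
  show "AE x in distr (sample_space M d) borel (\<lambda>\<delta>. 1 - V \<delta>). x \<in> {0..1}"
    using error_in_unit by (subst AE_distr_iff) auto
  fix m assume m: "d \<le> m"
  \<comment> \<open>With \<open>g = 1\<close>, the expected number of compression sets is the total
    mass of the sample space.\<close>
  have "of_nat (m choose d) * (\<integral>\<^sup>+\<delta>. ennreal ((1 - V \<delta>) ^ (m - d)) \<partial>sample_space M d)
      = (\<integral>\<^sup>+\<delta>. 1 \<partial>sample_space M m)"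
    using nn_integral_hypothesis_error[OF m, of "\<lambda>_. 1"] by simp
  also have "\<dots> = 1"
    using prob_space.emeasure_space_1[OF prob_PiM] by simp
  finally show "of_nat (m choose d) * (\<integral>\<^sup>+x. ennreal (x ^ (m - d))
      \<partial>distr (sample_space M d) borel (\<lambda>\<delta>. 1 - V \<delta>)) = 1"
    by (subst nn_integral_distr) auto
qed

lemma nn_integral_error_tail:
  assumes m: "d \<le> m" and \<epsilon>: "\<epsilon> \<in> {0<..<1}"
  shows "(\<integral>\<^sup>+\<delta>. indicator {\<epsilon><..} (error M T (G (labeled T (compression_set T G d m \<delta>) \<delta>)))
      \<partial>sample_space M m)
    = ennreal (\<Sum>i<d. real (m choose i) * \<epsilon> ^ i * (1 - \<epsilon>) ^ (m - i))"
proof -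
  note [measurable] = error_G_measurable
  have "(\<integral>\<^sup>+\<delta>. ennreal ((1 - V \<delta>) ^ (m - d)) * indicator {\<epsilon><..} (V \<delta>) \<partial>sample_space M d)
      = (\<integral>\<^sup>+\<delta>. ennreal ((1 - V \<delta>) ^ (m - d)) * indicator {..<1 - \<epsilon>} (1 - V \<delta>) \<partial>sample_space M d)"
    by (intro nn_integral_cong) (simp add: indicator_def)
  also have "\<dots> = (\<integral>\<^sup>+x. ennreal (x ^ (m - d)) * indicator {..<1 - \<epsilon>} x
      \<partial>distr (sample_space M d) borel (\<lambda>\<delta>. 1 - V \<delta>))"
    by (subst nn_integral_distr) auto
  \<comment> \<open>The strict inequality becomes a closed half-line, as the beta law has no atom at
    \<open>1 - \<epsilon>\<close>.\<close>
  also have "\<dots> = (\<integral>\<^sup>+x. ennreal (x ^ (m - d)) * indicator {..1 - \<epsilon>} x \<partial>beta_law d)"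
    unfolding distr_accuracy
    by (intro nn_integral_cong_AE eventually_mono[OF AE_beta_law_neq[of "1 - \<epsilon>"]])
      (auto simp: indicator_def)
  finally show ?thesis
    using nn_integral_hypothesis_error[OF m, of "indicator {\<epsilon><..}"]
      nn_integral_beta_law_atMost[OF d_pos m, of "1 - \<epsilon>"] \<epsilon> by simp
qed

end

section \<open>Transfer to the algorithm\<close>

text \<open>Error events are available only for thresholds in \<open>(0, 1)\<close>. For values in
  \<open>[0, 1]\<close> other thresholds are trivial, except \<open>0\<close>, which is a limit of
  positive ones.\<close>

lemma borel_measurable_unit_valuedI:
  fixes f :: "'a \<Rightarrow> real"
  assumes range: "\<And>x. x \<in> space N \<Longrightarrow> f x \<in> {0..1}"
    and meas: "\<And>\<epsilon>. \<epsilon> \<in> {0<..<1} \<Longrightarrow> {x \<in> space N. \<epsilon> < f x} \<in> sets N"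
  shows "f \<in> borel_measurable N"
proof (rule borel_measurable_iff_greater[THEN iffD2], rule allI)
  fix a :: real
  consider "a < 0" | "a = 0" | "a \<in> {0<..<1}" | "1 \<le> a"
    by fastforce
  then show "{x \<in> space N. a < f x} \<in> sets N"
  proof cases
    case 1
    then have "{x \<in> space N. a < f x} = space N"
      using range by force
    then show ?thesis by simp
  next
    case 2
    \<comment> \<open>The shift by \<open>2\<close> keeps every threshold strictly below
      \<open>1\<close>.\<close>
    have "\<exists>n. 1 / real (n + 2) < f x" if "0 < f x" for x
    proof -
      obtain n where "inverse (real (Suc n)) < f x"
        using reals_Archimedean[OF \<open>0 < f x\<close>] by blast
      moreover have "1 / real (n + 2) \<le> inverse (real (Suc n))"
        by (simp add: field_simps)
      ultimately show ?thesis
        by (meson order_le_less_trans)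
    qed
    then have "{x \<in> space N. a < f x} = (\<Union>n. {x \<in> space N. 1 / real (n + 2) < f x})"
      using 2 by (auto intro: less_trans[rotated])
    then show ?thesis
      using meas by auto
  next
    case 3
    then show ?thesis by (rule meas)
  next
    case 4
    then have "{x \<in> space N. a < f x} = {}"
      using range by force
    then show ?thesis by (simp only: sets.empty_sets)
  qed
qed

theorem theorem3:
  fixes M :: "(real ^ 'n) measure"
    and T :: "(real ^ 'n) set"
    and d :: nat
    and G :: "((real ^ 'n) \<times> nat) list \<Rightarrow> (real ^ 'n) set"
    and A :: "nat \<Rightarrow> ((real ^ 'n) \<times> nat) list \<Rightarrow> (real ^ 'n) set"
  assumes "prob_space M"
    and "T \<in> sets M"
    and "d \<ge> 1"
    and "G \<in> labeled_tuples M d \<rightarrow> sets M"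
    and G_consistent: "\<And>m I \<delta>. m \<ge> d \<Longrightarrow> I \<in> index_sets d m \<Longrightarrow> \<delta> \<in> space (sample_space M m) \<Longrightarrow>
           consistent T (G (labeled T I \<delta>)) I \<delta>"
    and G_unique: "\<And>m. m \<ge> d \<Longrightarrow>
           (AE \<delta> in sample_space M m. \<exists>!I. is_compression_set T G d m \<delta> I)"
    and A_hypotheses: "\<And>m. m \<ge> d \<Longrightarrow> A m \<in> labeled_tuples M m \<rightarrow> sets M"
    and A_compression: "\<And>m \<delta>. m \<ge> d \<Longrightarrow> \<delta> \<in> space (sample_space M m) \<Longrightarrow>
           (\<exists>!I. is_compression_set T G d m \<delta> I) \<Longrightarrow>
           A m (labeled T {1..m} \<delta>) = G (labeled T (compression_set T G d m \<delta>) \<delta>)"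
    and consistency_measurable: "\<And>m I. m \<ge> d \<Longrightarrow> I \<in> index_sets d m \<Longrightarrow>
           {\<delta> \<in> space (sample_space M m). consistent T (G (labeled T I \<delta>)) {1..m} \<delta>}
             \<in> sets (sample_space M m)"
    and error_measurable: "\<And>m \<epsilon>. m \<ge> d \<Longrightarrow> \<epsilon> \<in> {0<..<1} \<Longrightarrow>
           error_event M T A m \<epsilon> \<in> sets (sample_space M m)"
  shows "PAC_T M T d A (\<lambda>m \<epsilon>. \<Sum>i = 0..d - 1. real (m choose i) * \<epsilon> ^ i * (1 - \<epsilon>) ^ (m - i))
    \<and> (\<forall>\<epsilon>\<in>{0<..<1}. \<forall>m\<ge>d.
         measure (sample_space M m)
           {\<delta> \<in> space (sample_space M m). error M T (A m (labeled T {1..m} \<delta>)) > \<epsilon>}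
         = (\<Sum>i = 0..d - 1. real (m choose i) * \<epsilon> ^ i * (1 - \<epsilon>) ^ (m - i)))"
proof -
  interpret prob_space M by fact
  \<comment> \<open>For \<open>m = d\<close> the only candidate is the full index set, and it is
    consistent by hypothesis. Hence uniqueness holds everywhere, \<open>A d\<close> coincides with
    \<open>G\<close>, and the error events of \<open>A d\<close> show that \<open>V\<close> is
    measurable.\<close>
  have compression_set_full: "compression_set T G d d \<delta> = {1..d}"
    and unique_full: "\<exists>!I. is_compression_set T G d d \<delta> I"
    if "\<delta> \<in> space (sample_space M d)" for \<delta>
  proof -
    have "index_sets d d = {{1..d}}"
      using card_subset_eq[of "{1..d}"] by (auto simp: index_sets_def)
    then have *: "is_compression_set T G d d \<delta> I \<longleftrightarrow> I = {1..d}" for I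
      using G_consistent[OF order_refl _ that, of "{1..d}"] by (auto simp: is_compression_set_def)
    then show "compression_set T G d d \<delta> = {1..d}" "\<exists>!I. is_compression_set T G d d \<delta> I"
      by (auto simp: compression_set_def)
  qed
  have A_full: "A d (labeled T {1..d} \<delta>) = G (labeled T {1..d} \<delta>)"
    if "\<delta> \<in> space (sample_space M d)" for \<delta>
    using A_compression[OF order_refl that unique_full[OF that]] compression_set_full[OF that] by simp
  interpret compression_scheme M T d G
  proof unfold_locales
    show "(\<lambda>\<delta>. error M T (G (labeled T {1..d} \<delta>))) \<in> borel_measurable (sample_space M d)"
    proof (rule borel_measurable_unit_valuedI)
      fix \<epsilon> :: real assume "\<epsilon> \<in> {0<..<1}"
      then show "{\<delta> \<in> space (sample_space M d). \<epsilon> < error M T (G (labeled T {1..d} \<delta>))}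
          \<in> sets (sample_space M d)"
        using error_measurable[OF order_refl] A_full
        by (simp add: error_event_def cong: conj_cong)
    qed (simp add: error_def)
  qed (use assms in auto)
  \<comment> \<open>This uses \<open>d \<ge> 1\<close>: for \<open>d = 0\<close>, truncated
    subtraction would leave the term \<open>i = 0\<close>.\<close>
  have sum_eq: "(\<Sum>i = 0..d - 1. f i) = (\<Sum>i<d. f i)" for f :: "nat \<Rightarrow> real"
    using \<open>d \<ge> 1\<close> by (intro sum.cong) auto
  have tail: "measure (sample_space M m) (error_event M T A m \<epsilon>)
      = (\<Sum>i = 0..d - 1. real (m choose i) * \<epsilon> ^ i * (1 - \<epsilon>) ^ (m - i))"
    if m: "m \<ge> d" and \<epsilon>: "\<epsilon> \<in> {0<..<1}" for m \<epsilon>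
  proof -
    have "emeasure (sample_space M m) (error_event M T A m \<epsilon>)
        = (\<integral>\<^sup>+\<delta>. indicator (error_event M T A m \<epsilon>) \<delta> \<partial>sample_space M m)"
      using error_measurable[OF m \<epsilon>] by simp
    also have "\<dots> = (\<integral>\<^sup>+\<delta>. indicator {\<epsilon><..}
        (error M T (G (labeled T (compression_set T G d m \<delta>) \<delta>))) \<partial>sample_space M m)"
    proof (rule nn_integral_cong_AE)
      show "AE \<delta> in sample_space M m. indicator (error_event M T A m \<epsilon>) \<delta>
          = (indicator {\<epsilon><..} (error M T (G (labeled T (compression_set T G d m \<delta>) \<delta>))) :: ennreal)"
        using G_unique[OF m] AE_space
        by eventually_elim (simp add: A_compression[OF m] error_event_def indicator_def)
    qed
    also have "\<dots> = ennreal (\<Sum>i<d. real (m choose i) * \<epsilon> ^ i * (1 - \<epsilon>) ^ (m - i))"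
      by (rule nn_integral_error_tail[OF m \<epsilon>])
    finally show ?thesis
      \<comment> \<open>Nonnegativity of the sum is what allows passing from \<open>ennreal\<close>
        back to the reals.\<close>
      using binomial_tail_in_unit[of \<epsilon> m d] \<epsilon> by (simp add: measure_def sum_eq)
  qed
  have "PAC_T M T d A (\<lambda>m \<epsilon>. \<Sum>i = 0..d - 1. real (m choose i) * \<epsilon> ^ i * (1 - \<epsilon>) ^ (m - i))"
    unfolding PAC_T_def
  proof (intro conjI ballI allI impI)
    fix \<epsilon> :: real assume \<epsilon>: "\<epsilon> \<in> {0<..<1}"
    show "(\<Sum>i = 0..d - 1. real (m choose i) * \<epsilon> ^ i * (1 - \<epsilon>) ^ (m - i)) \<in> {0..1}" for m
      unfolding sum_eq using \<epsilon> by (intro binomial_tail_in_unit) auto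
    show "(\<lambda>m. \<Sum>i = 0..d - 1. real (m choose i) * \<epsilon> ^ i * (1 - \<epsilon>) ^ (m - i)) \<longlonglongrightarrow> 0"
      using \<epsilon> by (intro tendsto_null_sum binomial_term_tendsto_0) auto
  qed (use A_hypotheses error_measurable tail in auto)
  then show ?thesis
    using tail by (auto simp: error_event_def)
qed

end
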